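(* Let $\boldsymbol X^*=(X_{1^*},\dots,X_{d^*})$ be an arbitrarily ordered recursive max-linear (ML) vector with ML coefficient matrix $A^*$ satisfying assumptions (A1)-(A3) of the context, and let $\boldsymbol X_\nu$ be its reordering on a well-ordered DAG. Let $1\le h\le d-1$ and let $\boldsymbol h=\{\nu^{-1}(d),\dots,\nu^{-1}(d-h+1)\}$ be the first $h$ nodes of $\boldsymbol X_\nu$, which have already been ordered; let $\boldsymbol h^c=\{1^*,\dots,d^*\}\setminus\boldsymbol h$. For $a>0$ and $m^*\notin\boldsymbol h$ let $$M_{\boldsymbol h_a,m^*_a,\{\boldsymbol h\cup\{m^*\}\}^c}=\max\Big(aX_{\nu^{-1}(d)},\dots,aX_{\nu^{-1}(d-h+1)},\,aX_{m^*},\,\max_{k^*\notin\boldsymbol h\cup\{m^*\}}X_{k^*}\Big),$$ $M_{\boldsymbol h,m^*}=\max_{k^*\in\boldsymbol h\cup\{m^*\}}X_{k^*}$, and let $M_{1,\dots,d}$ be the maximum of all components of $\boldsymbol X^*$. Then: (a) If $m^*\notin\boldsymbol h$ has no ancestors in $\boldsymbol h^c$, then for all scalars $a>1$ $$\sigma^2_{M_{\boldsymbol h_a,m^*_a,\{\boldsymbol h\cup\{m^*\}\}^c}}-\sigma^2_{M_{1,\dots,d}}=(a^2-1)\,\sigma^2_{M_{\boldsymbol h,m^*}}.\qquad(\ast)$$ (b) If there exists a scalar $a>1$ such that $(\ast)$ holds for $m^*\notin\boldsymbol h$, then $m^*$ can be identified as the $(h+1)$-th node, i.e. $m^*$ has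 no ancestors in $\boldsymbol h^c$ (so that there is a relabelling of the nodes making the DAG well-ordered in which the nodes in $\boldsymbol h$ keep the labels $d,\dots,d-h+1$ and $m^*$ receives the label $d-h$).
   Context: Recursive ML vector. Let $\mathcal D=(V,E)$ be a DAG with nodes $V=\{1,\dots,d\}$; $\mathrm{pa}(i)$ are the parents of $i$, $\mathrm{an}(i)$ the ancestors of $i$ (not including $i$), $\mathrm{An}(i)=\mathrm{an}(i)\cup\{i\}$. $\mathcal D$ is well-ordered if $i<j$ for all $i\in V$ and $j\in\mathrm{pa}(i)$. An innovations vector $\boldsymbol Z=(Z_1,\dots,Z_d)$ has independent, atom-free components with support $\mathbb R_+$. Given edge weights $c_{ik}>0$ for $k\in\mathrm{pa}(i)\cup\{i\}$, define $X_i=\bigvee_{k\in\mathrm{pa}(i)}c_{ik}X_k\vee c_{ii}Z_i$. For a path $p=[j\to k_1\to\cdots\to k_l=i]$ put $d(p)=c_{jj}c_{k_1j}\cdots c_{ik_{l-1}}$; let $a_{ij}=\max_p d(p)$ over all paths from $j$ to $i$ if $j\in\mathrm{an}(i)$, $a_{ii}=c_{ii}$, and $a_{ij}=0$ if $j\notin\mathrm{An}(i)$. Then $X_i=\bigvee_{j=1}^d a_{ij}Z_j$, written $\boldsymbol X=A\times_{\max}\boldsymbol Z$; $\boldsymbol X$ is called a recursive ML vector and $A=(a_{ij})$ its ML coefficient matrix. Arbitrarily ordered vector. $\boldsymbol X^*=A^*\times_{\max}\boldsymbol Z$, $A^*=(a_{i^*k})$, is obtained by permuting rows: there is a bijection $\nu:\{1^*,\dots,d^*\}\to\{1,\dots,d\}$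 with $a_{i^*k}=a_{\nu(i^* )k}$ and $X_{i^*}=X_{\nu(i^* )}$, where $A=A_\nu=(a_{ik})$ is the (upper triangular) ML coefficient matrix of the recursive ML vector $\boldsymbol X_\nu=A\times_{\max}\boldsymbol Z$ on a well-ordered DAG. Node notions for $i^*$ (ancestor etc.) refer to the node $\nu(i^* )$ of this DAG. Regular variation. $\boldsymbol Y\in\mathbb R^d_+$ is in $RV^d_+(2)$ (with normalizing sequence $b_n=\sqrt n$ and the Euclidean norm) if, for $R=\|\boldsymbol Y\|_2$ and $\boldsymbol\omega=\boldsymbol Y/R$, $n\mathbb P[(R/\sqrt n,\boldsymbol\omega)\in\cdot]\to\nu_2\times H_{\boldsymbol Y}$ vaguely on $(0,\infty]\times\Theta_+^{d-1}$, where $d\nu_2(x)=2x^{-3}dx$, $\Theta_+^{d-1}=\{\boldsymbol\omega\in\mathbb R_+^d:\|\boldsymbol\omega\|_2=1\}$ and $H_{\boldsymbol Y}$ is a finite (spectral) measure. Scalings. For $Y\in RV^1_+(2)$ the squared scaling is $\sigma_Y^2=\lim_{n\to\infty}n\mathbb P(Y>\sqrt n)$. Assumptions. (A1) $\boldsymbol Z\in RV^d_+(2)$ has independent and standardized components: $n\mathbb P(n^{-1/2}Z_i>x)\to x^{-2}$ for all $x>0$ and all $i$. (A2) The norm is the Euclidean norm. (A3) The ML coefficient matrix is standardized, i.e. $a_{ij}$ is replaced by $a_{ij}/(\sum_{k=1}^da_{ik}^2)^{1/2}$, so that every row has Euclidean norm $1$. *)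

theory Defs
  imports "HOL-Probability.Probability"
begin

section \<open>Directed acyclic graphs\<close>

text \<open>Nodes are the numbers \<open>1, \<dots>, d\<close>; the pair \<open>(k, i)\<close> stands for the edge \<open>k \<rightarrow> i\<close>.\<close>

definition dag :: "nat \<Rightarrow> (nat \<times> nat) set \<Rightarrow> bool" where
  "dag d E \<longleftrightarrow> E \<subseteq> {1..d} \<times> {1..d} \<and> acyclic E"

definition pa :: "(nat \<times> nat) set \<Rightarrow> nat \<Rightarrow> nat set" where
  "pa E i = {k. (k, i) \<in> E}"

definition an :: "(nat \<times> nat) set \<Rightarrow> nat \<Rightarrow> nat set" where
  "an E i = {j. (j, i) \<in> E\<^sup>+}"

text \<open>Parents carry the larger labels, so \<open>d\<close> is a source node.\<close>

definition well_ordered :: "(nat \<times> nat) set \<Rightarrow> bool" where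
  "well_ordered E \<longleftrightarrow> (\<forall>i. \<forall>j \<in> pa E i. i < j)"

definition paths :: "(nat \<times> nat) set \<Rightarrow> nat \<Rightarrow> nat \<Rightarrow> nat list set" where
  "paths E j i = {p. 2 \<le> length p \<and> hd p = j \<and> last p = i \<and> successively (\<lambda>k l. (k, l) \<in> E) p}"


section \<open>Recursive max-linear vectors\<close>

text \<open>A weight matrix is a function \<open>c\<close> where \<open>c i k\<close> belongs to the edge \<open>k \<rightarrow> i\<close> and
  \<open>c i i\<close> to the innovation of \<open>i\<close>.\<close>

definition edge_weights :: "nat \<Rightarrow> (nat \<times> nat) set \<Rightarrow> (nat \<Rightarrow> nat \<Rightarrow> real) \<Rightarrow> bool" where
  "edge_weights d E c \<longleftrightarrow> (\<forall>i \<in> {1..d}. \<forall>k \<in> pa E i \<union> {i}. 0 < c i k)"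

definition path_weight :: "(nat \<Rightarrow> nat \<Rightarrow> real) \<Rightarrow> nat list \<Rightarrow> real" where
  "path_weight c p = c (hd p) (hd p) * (\<Prod>l<length p - 1. c (p ! Suc l) (p ! l))"

definition ml_coeff :: "(nat \<times> nat) set \<Rightarrow> (nat \<Rightarrow> nat \<Rightarrow> real) \<Rightarrow> nat \<Rightarrow> nat \<Rightarrow> real" where
  "ml_coeff E c i j =
     (if j = i then c i i
      else if j \<in> an E i then Max (path_weight c ` paths E j i)
      else 0)"

definition measure_support :: "'a::topological_space measure \<Rightarrow> 'a set" where
  "measure_support \<mu> = {x. \<forall>U. open U \<longrightarrow> x \<in> U \<longrightarrow> 0 < emeasure \<mu> U}"

definition innovations :: "'s measure \<Rightarrow> nat \<Rightarrow> (nat \<Rightarrow> 's \<Rightarrow> real) \<Rightarrow> bool" where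
  "innovations M d Z \<longleftrightarrow>
     prob_space.indep_vars M (\<lambda>_. borel) Z {1..d} \<and>
     (\<forall>i \<in> {1..d}. \<forall>x. measure M {w \<in> space M. Z i w = x} = 0) \<and>
     (\<forall>i \<in> {1..d}. measure_support (distr M borel (Z i)) = {0..})"

definition recursive_ml ::
    "'s measure \<Rightarrow> nat \<Rightarrow> (nat \<times> nat) set \<Rightarrow> (nat \<Rightarrow> nat \<Rightarrow> real) \<Rightarrow>
     (nat \<Rightarrow> 's \<Rightarrow> real) \<Rightarrow> (nat \<Rightarrow> 's \<Rightarrow> real) \<Rightarrow> bool" where
  "recursive_ml M d E c Z X \<longleftrightarrow>
     dag d E \<and> edge_weights d E c \<and> innovations M d Z \<and>
     (\<forall>i \<in> {1..d}. \<forall>w \<in> space M.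
        X i w = Max ((\<lambda>k. c i k * X k w) ` pa E i \<union> {c i i * Z i w}))"

definition standardized :: "nat \<Rightarrow> (nat \<Rightarrow> nat \<Rightarrow> real) \<Rightarrow> bool" where
  "standardized d A \<longleftrightarrow> (\<forall>i \<in> {1..d}. L2_set (A i) {1..d} = 1)"


section \<open>Regular variation and scalings\<close>

definition vague_convergence :: "'a topology \<Rightarrow> (nat \<Rightarrow> 'a measure) \<Rightarrow> 'a measure \<Rightarrow> bool" where
  "vague_convergence T \<mu> \<mu>\<^sub>0 \<longleftrightarrow>
     (\<forall>f K. continuous_map T euclideanreal f \<longrightarrow> compactin T K \<longrightarrow>
        (\<forall>x \<in> topspace T - K. f x = 0) \<longrightarrow>
        (\<lambda>n. \<integral>x. f x \<partial>\<mu> n) \<longlonglongrightarrow> (\<integral>x. f x \<partial>\<mu>\<^sub>0))"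

text \<open>Vectors of length \<open>d\<close> are extensional functions on \<open>{1..d}\<close>.\<close>

definition pos_sphere :: "nat \<Rightarrow> (nat \<Rightarrow> real) set" where
  "pos_sphere d = {\<omega> \<in> {1..d} \<rightarrow>\<^sub>E {0..}. L2_set \<omega> {1..d} = 1}"

definition sphere_algebra :: "nat \<Rightarrow> (nat \<Rightarrow> real) measure" where
  "sphere_algebra d = restrict_space (\<Pi>\<^sub>M i \<in> {1..d}. borel) (pos_sphere d)"

text \<open>The space \<open>(0, \<infinity>] \<times> \<Theta>\<close>: compact sets may reach \<open>\<infinity>\<close> but stay away from \<open>0\<close>.\<close>

definition polar_topology :: "nat \<Rightarrow> (ereal \<times> (nat \<Rightarrow> real)) topology" where
  "polar_topology d =
     prod_topology (top_of_set {0<..})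
       (subtopology (product_topology (\<lambda>_. euclideanreal) {1..d}) (pos_sphere d))"

definition polar_algebra :: "nat \<Rightarrow> (ereal \<times> (nat \<Rightarrow> real)) measure" where
  "polar_algebra d = restrict_space borel {0<..} \<Otimes>\<^sub>M sphere_algebra d"

definition nu2 :: "ereal measure" where
  "nu2 = distr (density (restrict_space lborel {0<..}) (\<lambda>x. ennreal (2 / x ^ 3)))
           (restrict_space borel {0<..}) ereal"

definition polar :: "nat \<Rightarrow> nat \<Rightarrow> (nat \<Rightarrow> 's \<Rightarrow> real) \<Rightarrow> 's \<Rightarrow> ereal \<times> (nat \<Rightarrow> real)" where
  "polar d n Y w =
     (let R = L2_set (\<lambda>i. Y i w) {1..d}
      in (ereal (R / sqrt (real n)), \<lambda>i \<in> {1..d}. Y i w / R))"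

text \<open>The measure \<open>n P[(R / \<surd>n, \<omega>) \<in> \<cdot>]\<close> on \<open>(0, \<infinity>] \<times> \<Theta>\<close>.  The restriction removes the
  event \<open>R = 0\<close> and the null set on which some component is negative.\<close>

definition polar_law :: "'s measure \<Rightarrow> nat \<Rightarrow> (nat \<Rightarrow> 's \<Rightarrow> real) \<Rightarrow> nat \<Rightarrow>
    (ereal \<times> (nat \<Rightarrow> real)) measure" where
  "polar_law M d Y n =
     scale_measure (of_nat n)
       (distr (restrict_space M {w \<in> space M. polar d n Y w \<in> {0<..} \<times> pos_sphere d})
          (polar_algebra d) (polar d n Y))"

definition regularly_varying2 :: "'s measure \<Rightarrow> nat \<Rightarrow> (nat \<Rightarrow> 's \<Rightarrow> real) \<Rightarrow> bool" where
  "regularly_varying2 M d Y \<longleftrightarrow>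
     (\<forall>i \<in> {1..d}. Y i \<in> borel_measurable M \<and> (AE w in M. 0 \<le> Y i w)) \<and>
     (\<exists>H. finite_measure H \<and> sets H = sets (sphere_algebra d) \<and>
        vague_convergence (polar_topology d) (polar_law M d Y) (nu2 \<Otimes>\<^sub>M H))"

definition standard_tails :: "'s measure \<Rightarrow> nat \<Rightarrow> (nat \<Rightarrow> 's \<Rightarrow> real) \<Rightarrow> bool" where
  "standard_tails M d Z \<longleftrightarrow>
     (\<forall>i \<in> {1..d}. \<forall>x>0.
        (\<lambda>n. real n * measure M {w \<in> space M. Z i w / sqrt (real n) > x}) \<longlonglongrightarrow> 1 / x\<^sup>2)"

definition sq_scaling :: "'s measure \<Rightarrow> ('s \<Rightarrow> real) \<Rightarrow> real" where
  "sq_scaling M Y = lim (\<lambda>n. real n * measure M {w \<in> space M. Y w > sqrt (real n)})"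


section \<open>Arbitrarily ordered vectors and their maxima\<close>

text \<open>Both the arbitrary labels and the well-ordered labels range over \<open>{1..d}\<close>; the bijection
  \<open>\<nu>\<close> sends an arbitrary label to the well-ordered one.  The first \<open>h\<close> nodes, as arbitrary
  labels:\<close>

definition first_nodes :: "nat \<Rightarrow> (nat \<Rightarrow> nat) \<Rightarrow> nat \<Rightarrow> nat set" where
  "first_nodes d \<nu> h = inv_into {1..d} \<nu> ` {d - h + 1..d}"

definition max_over :: "nat set \<Rightarrow> (nat \<Rightarrow> 's \<Rightarrow> real) \<Rightarrow> 's \<Rightarrow> real" where
  "max_over S X w = Max ((\<lambda>k. X k w) ` S)"

definition scaled_max :: "real \<Rightarrow> nat \<Rightarrow> nat set \<Rightarrow> (nat \<Rightarrow> 's \<Rightarrow> real) \<Rightarrow> 's \<Rightarrow> real" where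
  "scaled_max a d S X w = Max ((\<lambda>k. a * X k w) ` S \<union> (\<lambda>k. X k w) ` ({1..d} - S))"


section \<open>Standardizing is no loss of generality\<close>

text \<open>Dividing each row of an ML coefficient matrix by its Euclidean norm again gives the ML
  coefficient matrix of a recursive ML vector on the same DAG, with the edge weights below.
  Hence assuming \<^const>\<open>standardized\<close> for the coefficient matrix covers the replacement of
  an arbitrary coefficient matrix by its row-normalized version.\<close>

definition row_norm :: "nat \<Rightarrow> (nat \<times> nat) set \<Rightarrow> (nat \<Rightarrow> nat \<Rightarrow> real) \<Rightarrow> nat \<Rightarrow> real" where
  "row_norm d E c i = L2_set (ml_coeff E c i) {1..d}"

definition std_weights ::
    "nat \<Rightarrow> (nat \<times> nat) set \<Rightarrow> (nat \<Rightarrow> nat \<Rightarrow> real) \<Rightarrow> nat \<Rightarrow> nat \<Rightarrow> real" where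
  "std_weights d E c i k =
     (if k = i then c i i / row_norm d E c i
      else c i k * row_norm d E c k / row_norm d E c i)"

lemma row_norm_pos:
  assumes "edge_weights d E c" "i \<in> {1..d}"
  shows "0 < row_norm d E c i"
proof -
  have "0 < c i i" using assms by (auto simp: edge_weights_def)
  also have "c i i \<le> \<bar>ml_coeff E c i i\<bar>" by (simp add: ml_coeff_def)
  also have "\<dots> \<le> L2_set (ml_coeff E c i) {1..d}"
    using assms(2) member_le_L2_set[of "{1..d}" i "\<lambda>j. \<bar>ml_coeff E c i j\<bar>"]
    by (simp add: L2_set_def)
  finally show ?thesis by (simp add: row_norm_def)
qed

lemma successively_trancl:
  assumes "successively (\<lambda>k l. (k, l) \<in> E) p" "i < j" "j < length p"
  shows "(p ! i, p ! j) \<in> E\<^sup>+"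
  using assms(2,3)
proof (induction j)
  case 0
  then show ?case by simp
next
  case (Suc j)
  have e: "(p ! j, p ! Suc j) \<in> E"
    using assms(1) Suc.prems by (simp add: successively_conv_nth)
  show ?case
  proof (cases "i = j")
    case True
    then show ?thesis using e by auto
  next
    case False
    then show ?thesis using Suc e by (auto intro: trancl_into_trancl)
  qed
qed

lemma finite_paths:
  assumes "dag d E"
  shows "finite (paths E j i)"
proof (rule finite_subset)
  show "paths E j i \<subseteq> {p. set p \<subseteq> {1..d} \<and> distinct p}"
  proof
    fix p assume p: "p \<in> paths E j i"
    then have s: "successively (\<lambda>k l. (k, l) \<in> E) p" and len: "2 \<le> length p"
      by (auto simp: paths_def)
    have "p ! l \<in> {1..d}" if l: "l < length p" for l
    proof (cases l)
      case 0
      then have "(p ! l, p ! Suc l) \<in> E"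
        using s len by (simp add: successively_conv_nth)
      then show ?thesis using assms by (auto simp: dag_def)
    next
      case (Suc l')
      then have "(p ! l', p ! l) \<in> E"
        using s l by (simp add: successively_conv_nth)
      then show ?thesis using assms by (auto simp: dag_def)
    qed
    moreover have "distinct p"
    proof -
      have "p ! k \<noteq> p ! l" if "k < l" "l < length p" for k l
        using successively_trancl[OF s that] assms by (auto simp: dag_def acyclic_def)
      then show ?thesis
        unfolding distinct_conv_nth by (metis linorder_neqE_nat)
    qed
    ultimately show "p \<in> {p. set p \<subseteq> {1..d} \<and> distinct p}"
      by (auto simp: in_set_conv_nth)
  qed
  show "finite {p. set p \<subseteq> {1..d} \<and> distinct p}"
    by (rule finite_subset_distinct) simp
qed

lemma paths_nonempty:
  assumes "j \<in> an E i"
  shows "paths E j i \<noteq> {}"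
proof -
  have "(j, i) \<in> E\<^sup>+" using assms by (simp add: an_def)
  then show ?thesis
  proof (induction rule: trancl_induct)
    case (base y)
    then have "[j, y] \<in> paths E j y" by (simp add: paths_def)
    then show ?case by blast
  next
    case (step y z)
    then obtain p where "p \<in> paths E j y" by blast
    then have "p @ [z] \<in> paths E j z"
      using step.hyps by (auto simp: paths_def successively_append_iff hd_append)
    then show ?case by blast
  qed
qed

lemma path_weight_std:
  assumes "dag d E" "edge_weights d E c" "p \<in> paths E j i"
  shows "path_weight (std_weights d E c) p = path_weight c p / row_norm d E c i"
proof -
  let ?s = "row_norm d E c"
  have s: "successively (\<lambda>k l. (k, l) \<in> E) p" and len: "2 \<le> length p"
    using assms(3) by (auto simp: paths_def)
  then have ne: "p \<noteq> []" by auto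
  have hd: "hd p = p ! 0" and last: "i = p ! (length p - 1)"
    using assms(3) ne by (auto simp: paths_def hd_conv_nth last_conv_nth)
  have edge: "(p ! l, p ! Suc l) \<in> E" if "Suc l < length p" for l
    using s that by (simp add: successively_conv_nth)
  have pos: "0 < ?s (p ! l)" if "l < length p" for l
  proof -
    have "p ! l \<in> {1..d}"
    proof (cases "Suc l < length p")
      case True
      then show ?thesis using edge[of l] assms(1) by (auto simp: dag_def)
    next
      case False
      then show ?thesis using edge[of "l - 1"] assms(1) that len
        by (auto simp: dag_def)
    qed
    then show ?thesis by (rule row_norm_pos[OF assms(2)])
  qed
  have prod: "(\<Prod>l<n. std_weights d E c (p ! Suc l) (p ! l))
      = (\<Prod>l<n. c (p ! Suc l) (p ! l)) * ?s (p ! 0) / ?s (p ! n)" if "n < length p" for n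
    using that
  proof (induction n)
    case 0
    then show ?case using pos[of 0] by simp
  next
    case (Suc n)
    have ne: "p ! n \<noteq> p ! Suc n"
      using r_into_trancl[OF edge[of n]] Suc.prems assms(1) by (metis dag_def acyclic_def)
    show ?case
      using Suc ne pos[of n] pos[of "Suc n"] by (simp add: std_weights_def field_simps)
  qed
  show ?thesis
  proof -
    have "length p - 1 < length p" "0 < length p" using len by auto
    moreover have "std_weights d E c (hd p) (hd p) = c (p ! 0) (p ! 0) / ?s (p ! 0)"
      by (simp add: std_weights_def hd)
    ultimately show ?thesis
      using prod[of "length p - 1"] pos[of 0] last by (simp add: path_weight_def hd)
  qed
qed

lemma ml_coeff_std_weights:
  assumes "dag d E" "edge_weights d E c" "i \<in> {1..d}"
  shows "ml_coeff E (std_weights d E c) i j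
    = ml_coeff E c i j / sqrt (\<Sum>k\<in>{1..d}. (ml_coeff E c i k)\<^sup>2)"
proof -
  let ?s = "row_norm d E c i"
  have "Max (path_weight (std_weights d E c) ` paths E j i) = Max (path_weight c ` paths E j i) / ?s"
    if "j \<in> an E i"
  proof -
    have "path_weight (std_weights d E c) ` paths E j i
        = (\<lambda>x. x / ?s) ` path_weight c ` paths E j i"
      using path_weight_std[OF assms(1,2)] by (auto simp: image_image intro!: image_cong)
    moreover have "mono (\<lambda>x. x / ?s)"
      using row_norm_pos[OF assms(2,3)] by (auto simp: mono_def divide_right_mono)
    ultimately show ?thesis
      using mono_Max_commute[of "\<lambda>x. x / ?s" "path_weight c ` paths E j i"]
        finite_paths[OF assms(1)] paths_nonempty[OF that] by simp
  qed
  then have "ml_coeff E (std_weights d E c) i j = ml_coeff E c i j / ?s"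
    by (auto simp: ml_coeff_def std_weights_def[of d E c i i])
  then show ?thesis by (simp add: row_norm_def L2_set_def)
qed

lemma edge_weights_std_weights:
  assumes "dag d E" "edge_weights d E c"
  shows "edge_weights d E (std_weights d E c)"
  unfolding edge_weights_def
proof (intro ballI)
  fix i k assume ik: "i \<in> {1..d}" "k \<in> pa E i \<union> {i}"
  then have "k \<in> {1..d}" using assms(1) by (auto simp: pa_def dag_def)
  moreover have "0 < c i k" using assms(2) ik by (auto simp: edge_weights_def)
  ultimately show "0 < std_weights d E c i k"
    using row_norm_pos[OF assms(2)] ik(1) by (auto simp: std_weights_def)
qed

lemma standardized_std_weights:
  assumes "dag d E" "edge_weights d E c"
  shows "standardized d (ml_coeff E (std_weights d E c))"
  unfolding standardized_def
proof
  fix i assume i: "i \<in> {1..d}"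
  have "ml_coeff E (std_weights d E c) i = (\<lambda>j. (1 / row_norm d E c i) * ml_coeff E c i j)"
    using ml_coeff_std_weights[OF assms i] by (auto simp: row_norm_def L2_set_def)
  then have "L2_set (ml_coeff E (std_weights d E c) i) {1..d}
      = 1 / row_norm d E c i * L2_set (ml_coeff E c i) {1..d}"
    using row_norm_pos[OF assms(2) i]
    by (simp add: L2_set_right_distrib[symmetric] del: times_divide_eq_left)
  then show "L2_set (ml_coeff E (std_weights d E c) i) {1..d} = 1"
    using row_norm_pos[OF assms(2) i] by (simp add: row_norm_def)
qed

end

theory Submission
  imports Defs
begin

text \<open>A maximum of the components with positive weights \<open>u i\<close> is again max-linear in the
  innovations, with coefficients \<open>b j = Max\<^sub>i (u i * a i j)\<close>, and its squared scaling is
  \<open>\<Sum>j. (b j)\<^sup>2\<close>.  Writing \<open>r j\<close> and \<open>q j\<close> for the largest coefficient in column \<open>j\<close> over the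
  rows in and outside \<open>S = hs \<union> {m}\<close>, the two sides of the identity are therefore
  \<open>\<Sum>j. (max (a * r j) (q j))\<^sup>2 - (max (r j) (q j))\<^sup>2\<close> and \<open>(a\<^sup>2 - 1) * (\<Sum>j. (r j)\<^sup>2)\<close>.  The
  inequality \<open>\<le>\<close> holds term by term, with equality for column \<open>j\<close> iff \<open>r j = 0\<close> or
  \<open>q j \<le> r j\<close>.  Since a standardized coefficient matrix has its column maxima strictly on the
  diagonal, this happens for all columns iff \<open>S\<close> is closed under taking ancestors.\<close>

section \<open>Max-linear coefficients\<close>

lemma path_weight_snoc:
  assumes "p \<noteq> []"
  shows "path_weight c (p @ [i]) = path_weight c p * c i (last p)"
proof -
  obtain n where n: "length p = Suc n" using assms by (cases p) auto
  have "(\<Prod>l<n. c ((p @ [i]) ! Suc l) ((p @ [i]) ! l)) = (\<Prod>l<n. c (p ! Suc l) (p ! l))"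
    using n by (intro prod.cong) (auto simp: nth_append)
  then show ?thesis
    using n assms by (simp add: path_weight_def nth_append last_conv_nth)
qed

lemma paths_snoc:
  assumes "p \<in> paths E j k" "(k, i) \<in> E"
  shows "p @ [i] \<in> paths E j i"
  using assms by (auto simp: paths_def successively_append_iff hd_append)

lemma paths_imp_an:
  assumes "p \<in> paths E j i"
  shows "j \<in> an E i"
proof -
  have "(p ! 0, p ! (length p - 1)) \<in> E\<^sup>+"
    using assms by (intro successively_trancl) (auto simp: paths_def)
  moreover have "p \<noteq> []" using assms by (auto simp: paths_def)
  ultimately show ?thesis
    using assms by (simp add: paths_def an_def hd_conv_nth last_conv_nth)
qed

lemma not_in_an_self: "dag d E \<Longrightarrow> i \<notin> an E i"
  by (auto simp: dag_def an_def acyclic_def)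

lemma an_subset: "dag d E \<Longrightarrow> an E i \<subseteq> {1..d}"
  using trancl_subset_Sigma[of E "{1..d}"] by (auto simp: dag_def an_def)

lemma path_weight_le_ml_coeff:
  assumes "dag d E" "p \<in> paths E j i"
  shows "path_weight c p \<le> ml_coeff E c i j"
  using assms paths_imp_an[OF assms(2)] not_in_an_self[OF assms(1), of i] finite_paths[OF assms(1)]
  by (auto simp: ml_coeff_def)

lemma ml_coeff_eq_path_weight:
  assumes "dag d E" "j \<in> an E i"
  obtains p where "p \<in> paths E j i" "ml_coeff E c i j = path_weight c p"
proof -
  have "Max (path_weight c ` paths E j i) \<in> path_weight c ` paths E j i"
    using finite_paths[OF assms(1)] paths_nonempty[OF assms(2)] by (intro Max_in) auto
  moreover have "j \<noteq> i" using not_in_an_self[OF assms(1)] assms(2) by auto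
  ultimately show ?thesis using that assms(2) by (auto simp: ml_coeff_def)
qed

lemma path_weight_pos:
  assumes "dag d E" "edge_weights d E c" "p \<in> paths E j i"
  shows "0 < path_weight c p"
proof -
  have s: "successively (\<lambda>k l. (k, l) \<in> E) p" and len: "2 \<le> length p"
    using assms(3) by (auto simp: paths_def)
  have pos: "0 < c l k \<and> 0 < c k k" if "(k, l) \<in> E" for k l
    using that assms(1,2) by (auto simp: dag_def edge_weights_def pa_def)
  have edge: "(p ! l, p ! Suc l) \<in> E" if "Suc l < length p" for l
    using s that by (simp add: successively_conv_nth)
  have "hd p = p ! 0" using len by (intro hd_conv_nth) auto
  then have "0 < c (hd p) (hd p)" using pos[OF edge[of 0]] len by auto
  moreover have "0 < (\<Prod>l<length p - 1. c (p ! Suc l) (p ! l))"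
    using pos[OF edge] by (intro prod_pos) auto
  ultimately show ?thesis by (simp add: path_weight_def)
qed

lemma ml_coeff_pos:
  assumes "dag d E" "edge_weights d E c" "i \<in> {1..d}" "j = i \<or> j \<in> an E i"
  shows "0 < ml_coeff E c i j"
proof (cases "j = i")
  case True
  then show ?thesis using assms by (auto simp: ml_coeff_def edge_weights_def)
next
  case False
  then show ?thesis
    using assms path_weight_pos[OF assms(1,2)]
    by (metis ml_coeff_eq_path_weight)
qed

lemma ml_coeff_nonneg:
  assumes "dag d E" "edge_weights d E c" "i \<in> {1..d}"
  shows "0 \<le> ml_coeff E c i j"
proof (cases "j = i \<or> j \<in> an E i")
  case True
  then show ?thesis using ml_coeff_pos[OF assms] by (simp add: less_imp_le)
qed (auto simp: ml_coeff_def)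

text \<open>Extending a best path from \<open>j\<close> to \<open>k\<close> by the edge into
  \<open>i\<close> yields one competitor among the paths from \<open>j\<close> to \<open>i\<close>.
  For \<open>j = k\<close> the competitor is the edge itself; if \<open>j\<close> does not reach
  \<open>k\<close>, the left side is 0.\<close>

lemma ml_coeff_edge_le:
  assumes "dag d E" "edge_weights d E c" "(k, i) \<in> E"
  shows "c i k * ml_coeff E c k j \<le> ml_coeff E c i j"
proof -
  have i: "i \<in> {1..d}" using assms by (auto simp: dag_def)
  consider "j = k" | "j \<noteq> k" "j \<in> an E k" | "j \<noteq> k" "j \<notin> an E k" by blast
  then show ?thesis
  proof cases
    case 1
    have "[k, i] \<in> paths E k i" using assms(3) by (simp add: paths_def)
    from path_weight_le_ml_coeff[OF assms(1) this, of c] show ?thesis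
      using 1 by (simp add: path_weight_def ml_coeff_def[of E c k k] mult.commute)
  next
    case 2
    obtain p where p: "p \<in> paths E j k" "ml_coeff E c k j = path_weight c p"
      using ml_coeff_eq_path_weight[OF assms(1) 2(2)] by metis
    moreover have "p \<noteq> []" "last p = k" using p(1) by (auto simp: paths_def)
    ultimately show ?thesis
      using path_weight_le_ml_coeff[OF assms(1) paths_snoc[OF p(1) assms(3)], of c]
      by (simp add: path_weight_snoc mult.commute)
  next
    case 3
    then show ?thesis using ml_coeff_nonneg[OF assms(1,2) i] by (simp add: ml_coeff_def[of E c k j])
  qed
qed

text \<open>Cutting the last edge off a maximizing path leaves a path to a parent, whose weight is
  at most the best one. With the preceding bound this is the recursion over parents on which the
  later inductions rest.\<close>

lemma ml_coeff_last_edge: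
  assumes "dag d E" "edge_weights d E c" "j \<in> an E i"
  obtains k where "(k, i) \<in> E" "ml_coeff E c i j \<le> c i k * ml_coeff E c k j"
proof -
  obtain p where p: "p \<in> paths E j i" "ml_coeff E c i j = path_weight c p"
    using ml_coeff_eq_path_weight[OF assms(1,3)] by metis
  define q where "q = butlast p"
  have "p \<noteq> []" "last p = i" using p(1) by (auto simp: paths_def)
  then have pq: "p = q @ [i]"
    unfolding q_def by (metis append_butlast_last_id)
  then have q: "q \<noteq> []"
    using p(1) by (auto simp: paths_def)
  have e: "(last q, i) \<in> E" and sq: "successively (\<lambda>k l. (k, l) \<in> E) q" and hq: "hd q = j"
    using p(1) q by (auto simp: paths_def pq successively_append_iff hd_append)
  have "path_weight c q \<le> ml_coeff E c (last q) j"
  \<comment> \<open>If the maximizing path is a single edge, the prefix is one node and not a member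
    of \<open>paths\<close>; its weight is the diagonal coefficient.\<close>
  proof (cases "length q = 1")
    case True
    then have "q = [j]" using hq by (cases q) auto
    then show ?thesis by (simp add: path_weight_def ml_coeff_def)
  next
    case False
    then have "2 \<le> length q" using q by (cases q; cases "tl q") auto
    then have "q \<in> paths E j (last q)" using sq hq by (simp add: paths_def)
    then show ?thesis by (rule path_weight_le_ml_coeff[OF assms(1)])
  qed
  moreover have "0 < c i (last q)"
    using e assms(1,2) by (auto simp: dag_def edge_weights_def pa_def)
  ultimately show ?thesis
    using that[OF e] p(2) q by (simp add: pq path_weight_snoc mult.commute)
qed

section \<open>Column maxima on the diagonal and the max-linear representation\<close>

lemma wf_dag: "dag d E \<Longrightarrow> wf E"
  by (metis dag_def finite_acyclic_wf finite_SigmaI finite_atLeastAtMost finite_subset)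

text \<open>Joining a best path from \<open>k\<close> to \<open>j\<close> with one from
  \<open>j\<close> to \<open>i\<close> gives a path from \<open>k\<close> to \<open>i\<close>, but
  the product of the two weights contains \<open>c j j\<close> once too often; hence the factor on
  the right. Induction along the last edge avoids concatenating paths.\<close>

lemma ml_coeff_supermult:
  assumes "dag d E" "edge_weights d E c" "i \<in> {1..d}" "j \<in> {1..d}"
  shows "ml_coeff E c i j * ml_coeff E c j k \<le> ml_coeff E c j j * ml_coeff E c i k"
  using wf_dag[OF assms(1)] assms(3)
proof (induction i rule: wf_induct_rule)
  case (less i)
  let ?A = "ml_coeff E c"
  note nn = ml_coeff_nonneg[OF assms(1,2)]
  consider "j = i" | "j \<noteq> i" "j \<notin> an E i" | "j \<in> an E i" by blast
  then show ?case
  proof cases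
    case 1
    then show ?thesis by simp
  next
    case 2
    then show ?thesis using nn[OF assms(4)] nn[OF less.prems] by (simp add: ml_coeff_def[of E c i j])
  next
    case 3
    obtain l where l: "(l, i) \<in> E" "?A i j \<le> c i l * ?A l j"
      using ml_coeff_last_edge[OF assms(1,2) 3] by metis
    have ld: "l \<in> {1..d}" and pos: "0 < c i l"
      using l(1) assms(1,2) by (auto simp: dag_def edge_weights_def pa_def)
    have "?A i j * ?A j k \<le> c i l * (?A l j * ?A j k)"
      using mult_right_mono[OF l(2) nn[OF assms(4)], of k] by (simp add: mult.assoc)
    also have "\<dots> \<le> c i l * (?A j j * ?A l k)"
      using less.IH[OF l(1) ld] pos by (intro mult_left_mono) auto
    also have "\<dots> = ?A j j * (c i l * ?A l k)" by simp
    also have "\<dots> \<le> ?A j j * ?A i k"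
      using ml_coeff_edge_le[OF assms(1,2) l(1)] nn[OF assms(4)] by (intro mult_left_mono) auto
    finally show ?thesis .
  qed
qed

text \<open>For an ancestor \<open>j\<close> of \<open>i\<close>, compare row \<open>j\<close> times
  \<open>a_ij\<close> with row \<open>i\<close> times \<open>a_jj\<close>: supermultiplicativity
  orders the entries, and since both rows have norm 1 the norms are \<open>a_ij\<close> and
  \<open>a_jj\<close>.\<close>

lemma ml_coeff_less_diagonal:
  assumes "dag d E" "edge_weights d E c" and std: "standardized d (ml_coeff E c)"
    and ij: "i \<in> {1..d}" "j \<in> {1..d}" "i \<noteq> j"
  shows "ml_coeff E c i j < ml_coeff E c j j"
proof (cases "j \<in> an E i")
  case False
  then show ?thesis
    using ij ml_coeff_pos[OF assms(1,2) ij(2), of j] by (simp add: ml_coeff_def[of E c i j])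
next
  case True
  let ?A = "ml_coeff E c"
  note pos = ml_coeff_pos[OF assms(1,2)]
  note nn = ml_coeff_nonneg[OF assms(1,2)]
  have row: "(\<Sum>k\<in>{1..d}. (?A l k)\<^sup>2) = 1" if "l \<in> {1..d}" for l
    using std that by (simp add: standardized_def L2_set_def)
  have "(?A i j)\<^sup>2 = (\<Sum>k\<in>{1..d}. (?A i j * ?A j k)\<^sup>2)"
    using row[OF ij(2)] by (simp add: power_mult_distrib flip: sum_distrib_left)
  also have "\<dots> < (\<Sum>k\<in>{1..d}. (?A j j * ?A i k)\<^sup>2)"
  proof (rule sum_strict_mono_ex1)
    show "\<forall>k\<in>{1..d}. (?A i j * ?A j k)\<^sup>2 \<le> (?A j j * ?A i k)\<^sup>2"
      using ml_coeff_supermult[OF assms(1,2) ij(1,2)] nn ij by (intro ballI power_mono) auto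
    \<comment> \<open>Column \<open>i\<close> makes the comparison strict: by acyclicity
      \<open>i\<close> is no ancestor of \<open>j\<close>, so the left entry vanishes while the
      right one is positive.\<close>
    have "(i, j) \<notin> E\<^sup>+" "i \<noteq> j"
      using True assms(1) trancl_trans[of j i E j] by (auto simp: an_def dag_def acyclic_def)
    then have "?A j i = 0" by (auto simp: ml_coeff_def an_def)
    then have "(?A i j * ?A j i)\<^sup>2 < (?A j j * ?A i i)\<^sup>2"
      using pos[OF ij(1), of i] pos[OF ij(2), of j] by simp
    then show "\<exists>k\<in>{1..d}. (?A i j * ?A j k)\<^sup>2 < (?A j j * ?A i k)\<^sup>2"
      using ij by blast
  qed simp
  also have "\<dots> = (?A j j)\<^sup>2"
    using row[OF ij(1)] by (simp add: power_mult_distrib flip: sum_distrib_left)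
  finally show ?thesis
    using nn[OF ij(2)] by (rule power2_less_imp_less)
qed

text \<open>The representation \<open>X_i = max_j a_ij Z_j\<close>, in terms of exceedances of
  nonnegative levels. As an equation it can fail at outcomes with negative innovations, where zero
  coefficients contribute 0; above a nonnegative level only positive innovations count, so no null
  set has to be removed.\<close>

lemma recursive_ml_greater_iff:
  assumes "recursive_ml M d E c Z X" "w \<in> space M" "i \<in> {1..d}" "0 \<le> t"
  shows "t < X i w \<longleftrightarrow> (\<exists>j\<in>{1..d}. t < ml_coeff E c i j * Z j w)"
proof -
  let ?A = "ml_coeff E c"
  have dag: "dag d E" and ew: "edge_weights d E c"
    and rec: "\<And>i. i \<in> {1..d} \<Longrightarrow> X i w = Max ((\<lambda>k. c i k * X k w) ` pa E i \<union> {c i i * Z i w})"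
    using assms(1,2) by (auto simp: recursive_ml_def)
  show ?thesis
    using wf_dag[OF dag] assms(3,4)
  \<comment> \<open>The level varies because passing to a parent divides it by the edge
    weight.\<close>
  proof (induction i arbitrary: t rule: wf_induct_rule)
    case (less i)
    have "finite (pa E i)"
      by (rule finite_subset[of _ "{1..d}"]) (use dag in \<open>auto simp: dag_def pa_def\<close>)
    then have "t < X i w \<longleftrightarrow> t < c i i * Z i w \<or> (\<exists>k\<in>pa E i. t < c i k * X k w)"
      using rec[OF less.prems(1)] by (auto simp: Max_gr_iff)
    also have "(\<exists>k\<in>pa E i. t < c i k * X k w)
        \<longleftrightarrow> (\<exists>k\<in>pa E i. \<exists>j\<in>{1..d}. t < c i k * (?A k j * Z j w))"
    proof (intro bex_cong refl)
      fix k assume "k \<in> pa E i"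
      then have k: "(k, i) \<in> E" "k \<in> {1..d}" "0 < c i k"
        using dag ew by (auto simp: dag_def edge_weights_def pa_def)
      then have "t < c i k * X k w \<longleftrightarrow> t / c i k < X k w"
        by (simp add: divide_less_eq mult.commute)
      also have "\<dots> \<longleftrightarrow> (\<exists>j\<in>{1..d}. t / c i k < ?A k j * Z j w)"
        using less.IH[OF k(1,2)] k less.prems by simp
      also have "\<dots> \<longleftrightarrow> (\<exists>j\<in>{1..d}. t < c i k * (?A k j * Z j w))"
        using k by (simp add: divide_less_eq mult.commute)
      finally show "t < c i k * X k w \<longleftrightarrow> (\<exists>j\<in>{1..d}. t < c i k * (?A k j * Z j w))" .
    qed
    also have "t < c i i * Z i w \<or> (\<exists>k\<in>pa E i. \<exists>j\<in>{1..d}. t < c i k * (?A k j * Z j w))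
        \<longleftrightarrow> (\<exists>j\<in>{1..d}. t < ?A i j * Z j w)" (is "?L \<longleftrightarrow> ?R")
    proof
      assume ?L
      then show ?R
      proof
        assume "t < c i i * Z i w"
        then show ?R using less.prems(1) by (auto simp: ml_coeff_def)
      next
        assume "\<exists>k\<in>pa E i. \<exists>j\<in>{1..d}. t < c i k * (?A k j * Z j w)"
        then obtain k j where kj: "(k, i) \<in> E" "j \<in> {1..d}" "t < (c i k * ?A k j) * Z j w"
          by (auto simp: pa_def mult.assoc)
        have "0 \<le> c i k * ?A k j"
          using kj(1) ml_coeff_nonneg[OF dag ew] dag ew
          by (intro mult_nonneg_nonneg) (auto simp: dag_def edge_weights_def pa_def less_imp_le)
        \<comment> \<open>Exceeding a nonnegative level forces a positive innovation, so enlarging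
          the coefficient enlarges the product.\<close>
        moreover have "0 < (c i k * ?A k j) * Z j w" using kj(3) less.prems(2) by linarith
        ultimately have "0 < Z j w" by (simp add: zero_less_mult_iff)
        then have "(c i k * ?A k j) * Z j w \<le> ?A i j * Z j w"
          using ml_coeff_edge_le[OF dag ew kj(1)] by (intro mult_right_mono) auto
        then show ?R using kj by force
      qed
    next
      assume ?R
      then obtain j where j: "j \<in> {1..d}" "t < ?A i j * Z j w" by blast
      show ?L
      proof (cases "j = i")
        case True
        then show ?thesis using j by (simp add: ml_coeff_def)
      next
        case False
        have "0 < ?A i j * Z j w" using j less.prems(2) by linarith
        then have Z: "0 < Z j w" "?A i j \<noteq> 0"
          using ml_coeff_nonneg[OF dag ew less.prems(1), of j] by (auto simp: zero_less_mult_iff)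
        then have "j \<in> an E i" using False by (auto simp: ml_coeff_def split: if_splits)
        then obtain k where k: "(k, i) \<in> E" "?A i j \<le> c i k * ?A k j"
          using ml_coeff_last_edge[OF dag ew] by metis
        then have "?A i j * Z j w \<le> c i k * (?A k j * Z j w)"
          using Z mult_right_mono[OF k(2), of "Z j w"] by (simp add: mult.assoc)
        then have "t < c i k * (?A k j * Z j w)" using j(2) by linarith
        then show ?thesis using k(1) j(1) by (auto simp: pa_def)
      qed
    qed
    finally show ?case .
  qed
qed

section \<open>Scalings\<close>

text \<open>For independent events of probability \<open>p j n\<close>, the scaled probability of
  their union is asymptotically additive. The induction uses
  \<open>1 - (1 - p) P = p + (1 - p) (1 - P)\<close>; convergence of \<open>n p\<close> forces
  \<open>p\<close> to 0, which removes the cross term.\<close>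

lemma tendsto_scaled_complement_prod:
  fixes p :: "'i \<Rightarrow> nat \<Rightarrow> real"
  assumes "finite J" "\<And>j. j \<in> J \<Longrightarrow> (\<lambda>n. real n * p j n) \<longlonglongrightarrow> l j"
  shows "(\<lambda>n. real n * (1 - (\<Prod>j\<in>J. 1 - p j n))) \<longlonglongrightarrow> (\<Sum>j\<in>J. l j)"
  using assms
proof (induction J rule: finite_induct)
  case empty
  then show ?case by simp
next
  case (insert x J)
  let ?P = "\<lambda>n. \<Prod>j\<in>J. 1 - p j n"
  have x: "(\<lambda>n. real n * p x n) \<longlonglongrightarrow> l x" using insert by auto
  have IH: "(\<lambda>n. real n * (1 - ?P n)) \<longlonglongrightarrow> (\<Sum>j\<in>J. l j)" using insert by auto
  have "(\<lambda>n. inverse (real n) * (real n * p x n)) \<longlonglongrightarrow> 0 * l x"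
    by (intro tendsto_mult x lim_inverse_n)
  moreover have "\<forall>\<^sub>F n in sequentially. inverse (real n) * (real n * p x n) = p x n"
    using eventually_gt_at_top[of 0] by eventually_elim simp
  ultimately have p0: "p x \<longlonglongrightarrow> 0"
    by (simp add: filterlim_cong)
  have "(\<lambda>n. real n * p x n + (1 - p x n) * (real n * (1 - ?P n)))
      \<longlonglongrightarrow> l x + (1 - 0) * (\<Sum>j\<in>J. l j)"
    by (intro tendsto_intros x IH p0)
  moreover have "real n * p x n + (1 - p x n) * (real n * (1 - ?P n))
      = real n * (1 - (\<Prod>j\<in>insert x J. 1 - p j n))" for n
    using insert by (simp add: algebra_simps)
  ultimately show ?case using insert by simp
qed

text \<open>The exceedance event is a union of independent events, one per innovation, each
  contributing its own squared coefficient in the limit.\<close>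

lemma sq_scaling_max_linear:
  assumes "prob_space M" and indep: "prob_space.indep_vars M (\<lambda>_. borel) Z {1..d}"
    and tails: "standard_tails M d Z"
    and b: "\<And>j. j \<in> {1..d} \<Longrightarrow> 0 \<le> b j"
    and Y: "\<And>w t. w \<in> space M \<Longrightarrow> 0 \<le> t \<Longrightarrow> t < Y w \<longleftrightarrow> (\<exists>j\<in>{1..d}. t < b j * Z j w)"
  shows "sq_scaling M Y = (\<Sum>j\<in>{1..d}. (b j)\<^sup>2)"
proof -
  interpret prob_space M by fact
  let ?I = "{1..d}"
  define A where "A n j = {w \<in> space M. sqrt (real n) < b j * Z j w}" for n j
  have meas: "Z j \<in> borel_measurable M" if "j \<in> ?I" for j
    using indep that by (auto simp: indep_vars_def)
  have A: "A n j \<in> events" if "j \<in> ?I" for n j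
    unfolding A_def using meas[OF that] by measurable
  have "(\<lambda>n. real n * prob (A n j)) \<longlonglongrightarrow> (b j)\<^sup>2" if j: "j \<in> ?I" for j
  proof (cases "b j = 0")
    case True
    then show ?thesis by (simp add: A_def)
  next
    case False
    then have pos: "0 < b j" using b[OF j] by simp
    \<comment> \<open>The tail is evaluated at \<open>1 / b j\<close>, since
      \<open>b j * Z j\<close> exceeds \<open>sqrt n\<close> exactly when
      \<open>Z j / sqrt n\<close> exceeds \<open>1 / b j\<close>.\<close>
    then have "(\<lambda>n. real n * prob {w \<in> space M. Z j w / sqrt (real n) > 1 / b j})
        \<longlonglongrightarrow> 1 / (1 / b j)\<^sup>2"
      using tails j by (simp add: standard_tails_def)
    moreover have "{w \<in> space M. Z j w / sqrt (real n) > 1 / b j} = A n j" if "0 < n" for n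
      using that pos by (auto simp: A_def field_simps)
    then have "\<forall>\<^sub>F n in sequentially.
        real n * prob {w \<in> space M. Z j w / sqrt (real n) > 1 / b j} = real n * prob (A n j)"
      by (intro eventually_mono[OF eventually_gt_at_top[of 0]]) simp
    ultimately show ?thesis by (simp add: filterlim_cong power_divide)
  qed
  then have lim: "(\<lambda>n. real n * (1 - (\<Prod>j\<in>?I. 1 - prob (A n j)))) \<longlonglongrightarrow> (\<Sum>j\<in>?I. (b j)\<^sup>2)"
    by (intro tendsto_scaled_complement_prod) auto
  have "prob {w \<in> space M. Y w > sqrt (real n)} = 1 - (\<Prod>j\<in>?I. 1 - prob (A n j))" for n
  \<comment> \<open>The product rule for independent variables needs a nonempty index set.\<close>
  proof (cases "?I = {}")
    case True
    then show ?thesis using Y[of _ "sqrt (real n)"] by (auto simp: cong: conj_cong)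
  next
    case False
    let ?B = "\<lambda>j. {x. b j * x \<le> sqrt (real n)}"
    have "{w \<in> space M. Y w > sqrt (real n)} = space M - (\<Inter>j\<in>?I. Z j -` ?B j \<inter> space M)"
      using False by (auto simp: Y not_le simp del: One_nat_def atLeastAtMost_iff) (meson not_le)+
    also have "prob \<dots> = 1 - prob (\<Inter>j\<in>?I. Z j -` ?B j \<inter> space M)"
      using False meas by (intro prob_compl sets.finite_INT) (auto intro!: measurable_sets)
    also have "prob (\<Inter>j\<in>?I. Z j -` ?B j \<inter> space M) = (\<Prod>j\<in>?I. prob (Z j -` ?B j \<inter> space M))"
      using False by (intro indep_varsD[OF indep]) auto
    also have "\<dots> = (\<Prod>j\<in>?I. 1 - prob (A n j))"
    proof (intro prod.cong refl)
      fix j assume "j \<in> ?I"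
      have "Z j -` ?B j \<inter> space M = space M - A n j" by (auto simp: A_def)
      then show "prob (Z j -` ?B j \<inter> space M) = 1 - prob (A n j)"
        using prob_compl[OF A[OF \<open>j \<in> ?I\<close>]] by simp
    qed
    finally show ?thesis .
  qed
  then show ?thesis
    using lim by (simp add: sq_scaling_def limI)
qed

text \<open>After exchanging the quantifiers over rows and innovations, each innovation keeps only
  its largest weighted coefficient, because an exceeding term has a positive innovation. All three
  maxima in the identity are instances.\<close>

lemma sq_scaling_weighted_Max:
  fixes A :: "'i \<Rightarrow> nat \<Rightarrow> real"
  assumes "prob_space M" "prob_space.indep_vars M (\<lambda>_. borel) Z {1..d}" "standard_tails M d Z"
    and T: "finite T" "T \<noteq> {}" and u: "\<And>i. i \<in> T \<Longrightarrow> 0 < u i"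
    and A: "\<And>i j. i \<in> T \<Longrightarrow> 0 \<le> A i j"
    and Y: "\<And>i w t. i \<in> T \<Longrightarrow> w \<in> space M \<Longrightarrow> 0 \<le> t \<Longrightarrow>
      t < Y i w \<longleftrightarrow> (\<exists>j\<in>{1..d}. t < A i j * Z j w)"
  shows "sq_scaling M (\<lambda>w. Max ((\<lambda>i. u i * Y i w) ` T))
    = (\<Sum>j\<in>{1..d}. (Max ((\<lambda>i. u i * A i j) ` T))\<^sup>2)"
proof (rule sq_scaling_max_linear[OF assms(1-3)])
  fix j
  show "0 \<le> Max ((\<lambda>i. u i * A i j) ` T)"
    using T u A by (auto simp: Max_ge_iff less_imp_le)
next
  fix w and t :: real
  assume w: "w \<in> space M" and t: "0 \<le> t"
  have "t < Max ((\<lambda>i. u i * Y i w) ` T) \<longleftrightarrow> (\<exists>i\<in>T. t < u i * Y i w)"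
    using T by (simp add: Max_gr_iff)
  also have "\<dots> \<longleftrightarrow> (\<exists>i\<in>T. \<exists>j\<in>{1..d}. t < u i * A i j * Z j w)"
  proof (intro bex_cong refl)
    fix i assume i: "i \<in> T"
    have "t < u i * Y i w \<longleftrightarrow> t / u i < Y i w" using u[OF i] by (simp add: divide_less_eq mult.commute)
    also have "\<dots> \<longleftrightarrow> (\<exists>j\<in>{1..d}. t / u i < A i j * Z j w)"
      using Y[OF i w] u[OF i] t by simp
    finally show "t < u i * Y i w \<longleftrightarrow> (\<exists>j\<in>{1..d}. t < u i * A i j * Z j w)"
      using u[OF i] by (simp add: divide_less_eq mult_ac)
  qed
  also have "\<dots> \<longleftrightarrow> (\<exists>j\<in>{1..d}. \<exists>i\<in>T. t < u i * A i j * Z j w)" by blast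
  also have "\<dots> \<longleftrightarrow> (\<exists>j\<in>{1..d}. t < Max ((\<lambda>i. u i * A i j) ` T) * Z j w)"
  proof (intro bex_cong refl)
    fix j
    have le: "u i * A i j \<le> Max ((\<lambda>i. u i * A i j) ` T)" if "i \<in> T" for i
      using T that by simp
    have nn: "0 \<le> u i * A i j" if "i \<in> T" for i
      using u[OF that] A[OF that] by simp
    have "Max ((\<lambda>i. u i * A i j) ` T) \<in> (\<lambda>i. u i * A i j) ` T" using T by (intro Max_in) auto
    then obtain i0 where i0: "i0 \<in> T" "Max ((\<lambda>i. u i * A i j) ` T) = u i0 * A i0 j" by blast
    show "(\<exists>i\<in>T. t < u i * A i j * Z j w) \<longleftrightarrow> t < Max ((\<lambda>i. u i * A i j) ` T) * Z j w"
    proof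
      assume "\<exists>i\<in>T. t < u i * A i j * Z j w"
      then obtain i where i: "i \<in> T" "t < u i * A i j * Z j w" by blast
      then have "0 < u i * A i j * Z j w" using t by linarith
      then have "0 < Z j w" using nn[OF i(1)] by (auto simp: zero_less_mult_iff)
      then show "t < Max ((\<lambda>i. u i * A i j) ` T) * Z j w"
        using i(2) mult_right_mono[OF le[OF i(1)], of "Z j w"] by linarith
    next
      assume "t < Max ((\<lambda>i. u i * A i j) ` T) * Z j w"
      then show "\<exists>i\<in>T. t < u i * A i j * Z j w" using i0 by auto
    qed
  qed
  finally show "t < Max ((\<lambda>i. u i * Y i w) ` T)
      \<longleftrightarrow> (\<exists>j\<in>{1..d}. t < Max ((\<lambda>i. u i * A i j) ` T) * Z j w)" .
qed

section \<open>Comparing the two sides of the identity column by column\<close>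

lemma max_scaled_sq_diff:
  fixes a q r :: real
  assumes "1 < a" "0 \<le> r" "0 \<le> q"
  shows "(max (a * r) q)\<^sup>2 - (max r q)\<^sup>2 \<le> (a\<^sup>2 - 1) * r\<^sup>2"
    and "(max (a * r) q)\<^sup>2 - (max r q)\<^sup>2 = (a\<^sup>2 - 1) * r\<^sup>2 \<longleftrightarrow> r = 0 \<or> q \<le> r"
proof -
  have ar: "r \<le> a * r" using assms by (simp add: mult_le_cancel_right1)
  \<comment> \<open>If \<open>a * r\<close> does not exceed \<open>q\<close>, the left side is 0.
    Otherwise it is \<open>(a * r)\<^sup>2 - q\<^sup>2\<close>, which is too small because
    \<open>q\<close> exceeds \<open>r\<close>.\<close>
  have strict: "(max (a * r) q)\<^sup>2 - (max r q)\<^sup>2 < (a\<^sup>2 - 1) * r\<^sup>2" if "r \<noteq> 0" "r < q"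
  proof -
    have r: "0 < r" using that assms by simp
    show ?thesis
    proof (cases "a * r \<le> q")
      case True
      have "0 < (a\<^sup>2 - 1) * r\<^sup>2" using r assms(1) by (simp add: one_less_power)
      then show ?thesis using True that by simp
    next
      case False
      have "r\<^sup>2 < q\<^sup>2" using that r by (intro power_strict_mono) auto
      then show ?thesis using False that by (simp add: algebra_simps power_mult_distrib)
    qed
  qed
  have eq: "(max (a * r) q)\<^sup>2 - (max r q)\<^sup>2 = (a\<^sup>2 - 1) * r\<^sup>2" if "r = 0 \<or> q \<le> r"
    using that
  proof
    assume "q \<le> r"
    then have "max (a * r) q = a * r" "max r q = r" using ar by auto
    then show ?thesis by (simp add: algebra_simps power_mult_distrib)
  qed simp
  show "(max (a * r) q)\<^sup>2 - (max r q)\<^sup>2 \<le> (a\<^sup>2 - 1) * r\<^sup>2"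
    using strict eq by (metis less_imp_le not_le order_refl)
  show "(max (a * r) q)\<^sup>2 - (max r q)\<^sup>2 = (a\<^sup>2 - 1) * r\<^sup>2 \<longleftrightarrow> r = 0 \<or> q \<le> r"
    using strict eq by (metis less_irrefl not_le)
qed

text \<open>The two sides differ by a sum of nonnegative column deficits, which vanishes only if
  each deficit does. The condition is stated with quantifiers over rows instead of maxima, so that
  it can be reindexed along a bijection of the nodes.\<close>

lemma sq_scaling_identity_iff:
  fixes A :: "nat \<Rightarrow> nat \<Rightarrow> real"
  assumes "prob_space M" "prob_space.indep_vars M (\<lambda>_. borel) Z {1..d}" "standard_tails M d Z"
    and A: "\<And>i j. i \<in> {1..d} \<Longrightarrow> 0 \<le> A i j"
    and Y: "\<And>i w t. i \<in> {1..d} \<Longrightarrow> w \<in> space M \<Longrightarrow> 0 \<le> t \<Longrightarrow>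
      t < Y i w \<longleftrightarrow> (\<exists>j\<in>{1..d}. t < A i j * Z j w)"
    and S: "S \<subseteq> {1..d}" "S \<noteq> {}" and a: "1 < a"
  shows "sq_scaling M (scaled_max a d S Y) - sq_scaling M (max_over {1..d} Y)
      = (a\<^sup>2 - 1) * sq_scaling M (max_over S Y)
    \<longleftrightarrow> (\<forall>j\<in>{1..d}. (\<forall>i\<in>S. A i j = 0) \<or> (\<forall>k\<in>{1..d} - S. \<exists>i\<in>S. A k j \<le> A i j))"
proof -
  let ?I = "{1..d}"
  have fS: "finite S" and I: "?I = S \<union> (?I - S)" and Ine: "?I \<noteq> {}"
    using S finite_subset by auto
  define r where "r j = Max ((\<lambda>i. A i j) ` S)" for j
  \<comment> \<open>The inserted \<open>0\<close> makes the maximum meaningful when \<open>S\<close> contains all nodes.\<close>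
  define q where "q j = Max (insert 0 ((\<lambda>i. A i j) ` (?I - S)))" for j
  have A': "0 \<le> A i j" if "i \<in> S" for i j using A S that by auto
  have r0: "0 \<le> r j" for j
    unfolding r_def using S fS A' by (auto simp: Max_ge_iff)
  have q0: "0 \<le> q j" for j
    unfolding q_def by simp
  have split_Max: "Max ((\<lambda>i. (if i \<in> S then v else 1) * A i j) ` ?I) = max (v * r j) (q j)"
    if v: "0 < v" for v j
  proof (rule antisym)
    have "(if i \<in> S then v else 1) * A i j \<le> max (v * r j) (q j)" if "i \<in> ?I" for i
      using that v fS by (auto simp: r_def q_def le_max_iff_disj)
    then show "Max ((\<lambda>i. (if i \<in> S then v else 1) * A i j) ` ?I) \<le> max (v * r j) (q j)"
      using Ine by (subst Max_le_iff) auto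
  next
    let ?m = "Max ((\<lambda>i. (if i \<in> S then v else 1) * A i j) ` ?I)"
    have ge: "(if i \<in> S then v else 1) * A i j \<le> ?m" if "i \<in> ?I" for i
      using that by (intro Max_ge) auto
    have "r j \<in> (\<lambda>i. A i j) ` S" unfolding r_def using S fS by (intro Max_in) auto
    then obtain i0 where i0: "i0 \<in> S" "r j = A i0 j" by blast
    have r': "v * r j \<le> ?m" using ge[of i0] i0 S by auto
    \<comment> \<open>This bound is for the 0 inserted into the maximum \<open>q j\<close>.\<close>
    moreover have "0 \<le> ?m" using r' v r0[of j] by (meson mult_nonneg_nonneg order_trans less_imp_le)
    moreover have "A i j \<le> ?m" if "i \<in> ?I - S" for i
      using ge[of i] that by (simp only: Diff_iff if_False mult_1_left)
    ultimately show "max (v * r j) (q j) \<le> ?m"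
      unfolding q_def by (auto simp: Max_le_iff)
  qed
  have max_eq: "scaled_max v d S Y = (\<lambda>w. Max ((\<lambda>i. (if i \<in> S then v else 1) * Y i w) ` ?I))" for v
  proof
    fix w
    have "(\<lambda>i. (if i \<in> S then v else 1) * Y i w) ` ?I
        = (\<lambda>i. (if i \<in> S then v else 1) * Y i w) ` S \<union> (\<lambda>i. (if i \<in> S then v else 1) * Y i w) ` (?I - S)"
      using I by (metis image_Un)
    also have "\<dots> = (\<lambda>k. v * Y k w) ` S \<union> (\<lambda>k. Y k w) ` (?I - S)"
      by (intro arg_cong2[where f = "(\<union>)"] image_cong) auto
    finally show "scaled_max v d S Y w = Max ((\<lambda>i. (if i \<in> S then v else 1) * Y i w) ` ?I)"
      by (simp add: scaled_max_def)
  qed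
  have scaled: "sq_scaling M (scaled_max v d S Y) = (\<Sum>j\<in>?I. (max (v * r j) (q j))\<^sup>2)"
    if v: "0 < v" for v
  proof -
    have "sq_scaling M (scaled_max v d S Y)
        = (\<Sum>j\<in>?I. (Max ((\<lambda>i. (if i \<in> S then v else 1) * A i j) ` ?I))\<^sup>2)"
      unfolding max_eq using v A Y Ine by (intro sq_scaling_weighted_Max[OF assms(1-3)]) auto
    then show ?thesis by (simp only: split_Max[OF v])
  qed
  \<comment> \<open>Weight 1 gives the unscaled maximum, so one formula serves both terms on the
    left.\<close>
  have "max_over ?I Y = scaled_max 1 d S Y"
    unfolding max_eq by (auto simp: max_over_def)
  then have all: "sq_scaling M (max_over ?I Y) = (\<Sum>j\<in>?I. (max (r j) (q j))\<^sup>2)"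
    using scaled[of 1] by simp
  have part: "sq_scaling M (max_over S Y) = (\<Sum>j\<in>?I. (r j)\<^sup>2)"
  proof -
    have "sq_scaling M (\<lambda>w. Max ((\<lambda>i. 1 * Y i w) ` S)) = (\<Sum>j\<in>?I. (Max ((\<lambda>i. 1 * A i j) ` S))\<^sup>2)"
    proof (rule sq_scaling_weighted_Max[OF assms(1-3)])
      show "t < Y i w \<longleftrightarrow> (\<exists>j\<in>?I. t < A i j * Z j w)"
        if "i \<in> S" "w \<in> space M" "0 \<le> t" for i w t
        using Y that S by blast
    qed (use S A' fS in auto)
    then show ?thesis by (simp add: max_over_def[abs_def] r_def)
  qed
  let ?D = "\<lambda>j. (a\<^sup>2 - 1) * (r j)\<^sup>2 - ((max (a * r j) (q j))\<^sup>2 - (max (r j) (q j))\<^sup>2)"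
  have D: "0 \<le> ?D j" "?D j = 0 \<longleftrightarrow> r j = 0 \<or> q j \<le> r j" for j
    using max_scaled_sq_diff[OF a r0 q0, of j j] by auto
  have "sq_scaling M (scaled_max a d S Y) - sq_scaling M (max_over ?I Y)
      = (a\<^sup>2 - 1) * sq_scaling M (max_over S Y) \<longleftrightarrow> (\<Sum>j\<in>?I. ?D j) = 0"
    using scaled[of a] a all part by (auto simp: sum_subtractf sum_distrib_left)
  also have "\<dots> \<longleftrightarrow> (\<forall>j\<in>?I. ?D j = 0)"
    using D(1) by (intro sum_nonneg_eq_0_iff) auto
  also have "\<dots> \<longleftrightarrow> (\<forall>j\<in>?I. r j = 0 \<or> q j \<le> r j)"
    by (simp only: D(2))
  also have "\<dots> \<longleftrightarrow> (\<forall>j\<in>?I. (\<forall>i\<in>S. A i j = 0) \<or> (\<forall>k\<in>?I - S. \<exists>i\<in>S. A k j \<le> A i j))"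
  proof (intro ball_cong refl arg_cong2[where f = "(\<or>)"])
    fix j
    have "r j = 0 \<longleftrightarrow> r j \<le> 0" using r0[of j] by linarith
    also have "\<dots> \<longleftrightarrow> (\<forall>i\<in>S. A i j \<le> 0)" unfolding r_def using S fS by (simp add: Max_le_iff)
    finally show "r j = 0 \<longleftrightarrow> (\<forall>i\<in>S. A i j = 0)" using A' by (auto intro: antisym)
    have "q j \<le> r j \<longleftrightarrow> (\<forall>k\<in>?I - S. A k j \<le> r j)"
      unfolding q_def using r0[of j] by (auto simp: Max_le_iff)
    also have "\<dots> \<longleftrightarrow> (\<forall>k\<in>?I - S. \<exists>i\<in>S. A k j \<le> A i j)"
      unfolding r_def using S fS by (simp add: Max_ge_iff)
    finally show "q j \<le> r j \<longleftrightarrow> (\<forall>k\<in>?I - S. \<exists>i\<in>S. A k j \<le> A i j)" .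
  qed
  finally show ?thesis .
qed

section \<open>Ancestral sets and relabelling\<close>

text \<open>Columns inside \<open>T\<close> are harmless because row \<open>j\<close> holds the
  maximum of column \<open>j\<close>. A column \<open>j\<close> outside \<open>T\<close> causes a
  failure exactly when \<open>j\<close> is an ancestor of a member of \<open>T\<close>: it is then
  nonzero on \<open>T\<close>, yet its diagonal entry in row \<open>j\<close> exceeds every entry on
  \<open>T\<close>.\<close>

lemma coeff_condition_iff_ancestral:
  assumes "dag d E" "edge_weights d E c" "standardized d (ml_coeff E c)" and T: "T \<subseteq> {1..d}"
  shows "(\<forall>j\<in>{1..d}. (\<forall>i\<in>T. ml_coeff E c i j = 0) \<or>
      (\<forall>k\<in>{1..d} - T. \<exists>i\<in>T. ml_coeff E c k j \<le> ml_coeff E c i j)) \<longleftrightarrow> (\<forall>i\<in>T. an E i \<subseteq> T)"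
    (is "?L \<longleftrightarrow> ?R")
proof
  note less = ml_coeff_less_diagonal[OF assms(1-3)]
  assume L: ?L
  show ?R
  proof (intro ballI subsetI, rule ccontr)
    fix i j assume i: "i \<in> T" and j: "j \<in> an E i" "j \<notin> T"
    have jd: "j \<in> {1..d}"
      using j(1) an_subset[OF assms(1)] by blast
    have "0 < ml_coeff E c i j" using i T j by (intro ml_coeff_pos[OF assms(1,2)]) auto
    then have "\<not> (\<forall>i\<in>T. ml_coeff E c i j = 0)" using i by force
    \<comment> \<open>The violating row outside \<open>T\<close> is row \<open>j\<close>
      itself.\<close>
    then obtain k where "k \<in> T" "ml_coeff E c j j \<le> ml_coeff E c k j"
      using L jd j(2) by blast
    moreover have "ml_coeff E c k j < ml_coeff E c j j"
      using \<open>k \<in> T\<close> T j(2) jd by (intro less) auto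
    ultimately show False by simp
  qed
next
  assume R: ?R
  show ?L
  proof
    fix j assume jd: "j \<in> {1..d}"
    show "(\<forall>i\<in>T. ml_coeff E c i j = 0) \<or>
        (\<forall>k\<in>{1..d} - T. \<exists>i\<in>T. ml_coeff E c k j \<le> ml_coeff E c i j)"
    proof (cases "j \<in> T")
      case True
      have "ml_coeff E c k j \<le> ml_coeff E c j j" if "k \<in> {1..d} - T" for k
        using that True jd by (intro less_imp_le ml_coeff_less_diagonal[OF assms(1-3)]) auto
      then show ?thesis using True by blast
    next
      case False
      then have "ml_coeff E c i j = 0" if "i \<in> T" for i
        using R that by (auto simp: ml_coeff_def)
      then show ?thesis by blast
    qed
  qed
qed

section \<open>Moving a node up in a well-ordering\<close>

lemma well_ordered_an_less:
  assumes "well_ordered E" "j \<in> an E i"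
  shows "i < j"
proof -
  have "(j, i) \<in> E\<^sup>+" using assms(2) by (simp add: an_def)
  then show ?thesis
    by (induction rule: trancl_induct) (use assms(1) in \<open>force simp: well_ordered_def pa_def\<close>)+
qed

text \<open>Lifting \<open>v\<close> to position \<open>n\<close> and shifting the nodes in between
  down by one reverses the order only between \<open>v\<close> and those nodes. None of them is a
  parent of \<open>v\<close>, as its parents lie beyond \<open>n\<close>.\<close>

lemma well_ordered_move_up:
  assumes "dag d E" "well_ordered E" "1 \<le> v" "v \<le> n" "n \<le> d"
    and "\<And>k. (k, v) \<in> E \<Longrightarrow> n < k"
  obtains \<pi> where "bij_betw \<pi> {1..d} {1..d}" "\<And>i. n < i \<Longrightarrow> \<pi> i = i" "\<pi> v = n"
    "well_ordered (map_prod \<pi> \<pi> ` E)"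
proof
  \<comment> \<open>the cyclic shift of \<open>v, \<dots>, n\<close>\<close>
  define \<pi> where "\<pi> i = (if i < v \<or> n < i then i else if i = v then n else i - 1)" for i :: nat
  define \<rho> where "\<rho> i = (if i < v \<or> n < i then i else if i = n then v else i + 1)" for i :: nat
  show "bij_betw \<pi> {1..d} {1..d}"
    by (rule bij_betw_byWitness[where f' = \<rho>])
      (use assms(3-5) in \<open>auto simp: \<pi>_def \<rho>_def split: if_splits\<close>)
  show "\<pi> i = i" if "n < i" for i using that by (simp add: \<pi>_def)
  show "\<pi> v = n" using assms(4) by (simp add: \<pi>_def)
  have "\<pi> i < \<pi> k" if e: "(k, i) \<in> E" for i k
  proof -
    have "i < k" using assms(2) e by (auto simp: well_ordered_def pa_def)
    moreover have "i = v \<Longrightarrow> n < k" using assms(6) e by simp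
    ultimately show ?thesis using assms(3,4) by (auto simp: \<pi>_def)
  qed
  then show "well_ordered (map_prod \<pi> \<pi> ` E)"
    by (auto simp: well_ordered_def pa_def)
qed


section \<open>The scaling identity as a test for the next node\<close>

theorem theorem3:
  fixes M :: "'s measure"
    and d h :: nat
    and E :: "(nat \<times> nat) set"
    and c Astar :: "nat \<Rightarrow> nat \<Rightarrow> real"
    and \<nu> :: "nat \<Rightarrow> nat"
    and Z X Xstar :: "nat \<Rightarrow> 's \<Rightarrow> real"
    and hs :: "nat set"
    and m :: nat
  assumes "prob_space M"
    and "recursive_ml M d E c Z X"
    and "well_ordered E"
    and "bij_betw \<nu> {1..d} {1..d}"
    and "Xstar = (\<lambda>i. X (\<nu> i))"
    and "Astar = (\<lambda>i. ml_coeff E c (\<nu> i))"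
    and "regularly_varying2 M d Z"
    and "standard_tails M d Z"
    and "standardized d Astar"
    and "1 \<le> h" and "h \<le> d - 1"
    and "hs = first_nodes d \<nu> h"
    and "m \<in> {1..d} - hs"
  shows
    "({j \<in> {1..d} - hs. \<nu> j \<in> an E (\<nu> m)} = {} \<longrightarrow>
        (\<forall>a>1. sq_scaling M (scaled_max a d (hs \<union> {m}) Xstar) - sq_scaling M (max_over {1..d} Xstar)
               = (a\<^sup>2 - 1) * sq_scaling M (max_over (hs \<union> {m}) Xstar)))
     \<and>
     ((\<exists>a>1. sq_scaling M (scaled_max a d (hs \<union> {m}) Xstar) - sq_scaling M (max_over {1..d} Xstar)
               = (a\<^sup>2 - 1) * sq_scaling M (max_over (hs \<union> {m}) Xstar)) \<longrightarrow>
        {j \<in> {1..d} - hs. \<nu> j \<in> an E (\<nu> m)} = {} \<and>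
        (\<exists>\<pi>. bij_betw \<pi> {1..d} {1..d} \<and>
             (\<forall>i \<in> hs. \<pi> (\<nu> i) = \<nu> i) \<and> \<pi> (\<nu> m) = d - h \<and>
             well_ordered (map_prod \<pi> \<pi> ` E)))"
proof -
  have dag: "dag d E" and ew: "edge_weights d E c"
    and indep: "prob_space.indep_vars M (\<lambda>_. borel) Z {1..d}"
    using assms(2) by (auto simp: recursive_ml_def innovations_def)
  have \<nu>: "\<nu> i \<in> {1..d}" if "i \<in> {1..d}" for i
    using assms(4) that by (auto simp: bij_betw_def)
  have \<nu>_surj: "\<nu> ` {1..d} = {1..d}" and inj: "inj_on \<nu> {1..d}"
    using assms(4) by (auto simp: bij_betw_def)
  let ?S = "hs \<union> {m}" and ?T = "\<nu> ` (hs \<union> {m})"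
  have hsd: "hs \<subseteq> {1..d}"
    using bij_betw_imp_surj_on[OF bij_betw_inv_into[OF assms(4)]] assms(12)
    by (auto simp: first_nodes_def)
  have \<nu>_hs: "\<nu> ` hs = {d - h + 1..d}"
  proof -
    have "\<nu> (inv_into {1..d} \<nu> i) = i" if "i \<in> {d - h + 1..d}" for i
      using that \<nu>_surj by (intro f_inv_into_f) auto
    then show ?thesis using assms(12) by (simp add: first_nodes_def image_image)
  qed
  have S: "?S \<subseteq> {1..d}" "?S \<noteq> {}" using hsd assms(13) by auto
  have T: "?T \<subseteq> {1..d}" using S \<nu> by auto
  \<comment> \<open>Permuting rows keeps their norms, and \<open>\<nu>\<close> reaches every
    row.\<close>
  have std: "standardized d (ml_coeff E c)"
    unfolding standardized_def
  proof
    fix i assume "i \<in> {1..d}"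
    then obtain i' where "i' \<in> {1..d}" "i = \<nu> i'" using \<nu>_surj by blast
    then show "L2_set (ml_coeff E c i) {1..d} = 1"
      using assms(6,9) by (simp add: standardized_def)
  qed
  have compl: "\<nu> ` ({1..d} - ?S) = {1..d} - ?T"
    using inj_on_image_set_diff[OF inj, of "{1..d}" ?S] S \<nu>_surj by auto
  \<comment> \<open>The right side does not involve \<open>a\<close>: hence closure gives the
    identity for all \<open>a > 1\<close> in (a), and a single such \<open>a\<close> suffices in
    (b).\<close>
  have star: "sq_scaling M (scaled_max a d ?S Xstar) - sq_scaling M (max_over {1..d} Xstar)
      = (a\<^sup>2 - 1) * sq_scaling M (max_over ?S Xstar) \<longleftrightarrow> (\<forall>i\<in>?T. an E i \<subseteq> ?T)"
    if a: "1 < a" for a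
  proof -
    have "sq_scaling M (scaled_max a d ?S Xstar) - sq_scaling M (max_over {1..d} Xstar)
        = (a\<^sup>2 - 1) * sq_scaling M (max_over ?S Xstar)
      \<longleftrightarrow> (\<forall>j\<in>{1..d}. (\<forall>i\<in>?S. Astar i j = 0) \<or> (\<forall>k\<in>{1..d} - ?S. \<exists>i\<in>?S. Astar k j \<le> Astar i j))"
    proof (rule sq_scaling_identity_iff[OF assms(1) indep assms(8) _ _ S a])
      show "0 \<le> Astar i j" if "i \<in> {1..d}" for i j
        using ml_coeff_nonneg[OF dag ew \<nu>[OF that]] assms(6) by simp
      show "t < Xstar i w \<longleftrightarrow> (\<exists>j\<in>{1..d}. t < Astar i j * Z j w)"
        if "i \<in> {1..d}" "w \<in> space M" "0 \<le> t" for i w t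
        using recursive_ml_greater_iff[OF assms(2) that(2) \<nu>[OF that(1)] that(3)] assms(5,6) by simp
    qed
    also have "\<dots> \<longleftrightarrow> (\<forall>j\<in>{1..d}. (\<forall>i\<in>?T. ml_coeff E c i j = 0) \<or>
        (\<forall>k\<in>{1..d} - ?T. \<exists>i\<in>?T. ml_coeff E c k j \<le> ml_coeff E c i j))"
      unfolding compl[symmetric] assms(6) by (simp only: Set.ball_simps(9) Set.bex_simps(7))
    also have "\<dots> \<longleftrightarrow> (\<forall>i\<in>?T. an E i \<subseteq> ?T)"
      by (rule coeff_condition_iff_ancestral[OF dag ew std T])
    finally show ?thesis .
  qed
  note an_d = an_subset[OF dag]
  \<comment> \<open>The ordered nodes are the final segment of labels, and ancestors carry larger
    labels.\<close>
  have hs_closed: "an E i \<subseteq> \<nu> ` hs" if "i \<in> \<nu> ` hs" for i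
    using that well_ordered_an_less[OF assms(3), of _ i] an_d[of i] unfolding \<nu>_hs by force
  have m_self: "\<nu> m \<notin> an E (\<nu> m)" by (rule not_in_an_self[OF dag])
  \<comment> \<open>Only \<open>\<nu> m\<close> can break closure, and it is not its own
    ancestor.\<close>
  have closed_iff: "(\<forall>i\<in>?T. an E i \<subseteq> ?T) \<longleftrightarrow> an E (\<nu> m) \<subseteq> \<nu> ` hs"
    using hs_closed m_self by auto
  have anc_iff: "{j \<in> {1..d} - hs. \<nu> j \<in> an E (\<nu> m)} = {} \<longleftrightarrow> an E (\<nu> m) \<subseteq> \<nu> ` hs"
  proof
    assume L: "{j \<in> {1..d} - hs. \<nu> j \<in> an E (\<nu> m)} = {}"
    show "an E (\<nu> m) \<subseteq> \<nu> ` hs"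
    proof
      fix k assume k: "k \<in> an E (\<nu> m)"
      then have "k \<in> \<nu> ` {1..d}" using an_d \<nu>_surj by blast
      then show "k \<in> \<nu> ` hs" using L k by blast
    qed
  next
    assume R: "an E (\<nu> m) \<subseteq> \<nu> ` hs"
    show "{j \<in> {1..d} - hs. \<nu> j \<in> an E (\<nu> m)} = {}"
    proof (rule ccontr)
      assume "{j \<in> {1..d} - hs. \<nu> j \<in> an E (\<nu> m)} \<noteq> {}"
      then obtain j where "j \<in> {1..d}" "j \<notin> hs" "\<nu> j \<in> \<nu> ` hs" using R by blast
      then show False using inj_on_image_mem_iff[OF inj, of j hs] hsd by simp
    qed
  qed
  have relabel: "\<exists>\<pi>. bij_betw \<pi> {1..d} {1..d} \<and> (\<forall>i \<in> hs. \<pi> (\<nu> i) = \<nu> i) \<and> \<pi> (\<nu> m) = d - h \<and>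
      well_ordered (map_prod \<pi> \<pi> ` E)" if R: "an E (\<nu> m) \<subseteq> \<nu> ` hs"
  proof -
    have "\<nu> m \<notin> \<nu> ` hs" using inj_on_image_mem_iff[OF inj, of m hs] hsd assms(13) by simp
    then have "\<nu> m \<le> d - h" "1 \<le> \<nu> m" using \<nu>[of m] assms(13) unfolding \<nu>_hs by auto
    \<comment> \<open>Parents are ancestors, so they lie in the final segment;
      \<open>\<nu> m\<close> can thus be moved up to position \<open>d - h\<close> with the labels
      above it fixed.\<close>
    moreover have "d - h < k" if "(k, \<nu> m) \<in> E" for k
      using R that unfolding \<nu>_hs by (force simp: an_def)
    ultimately obtain \<pi> where \<pi>: "bij_betw \<pi> {1..d} {1..d}" "\<And>i. d - h < i \<Longrightarrow> \<pi> i = i"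
        "\<pi> (\<nu> m) = d - h" "well_ordered (map_prod \<pi> \<pi> ` E)"
      using well_ordered_move_up[OF dag assms(3), of "\<nu> m" "d - h"] by (metis diff_le_self)
    moreover have "d - h < \<nu> i" if "i \<in> hs" for i
      using imageI[OF that, of \<nu>] unfolding \<nu>_hs by simp
    ultimately show ?thesis by blast
  qed
  show ?thesis
    unfolding anc_iff using star closed_iff relabel by blast
qed

end
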